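(* Let $\mathbb{A}$ be a finite alphabet, $\pi=(<_D,<_A)$ a pair of distinct total orders on $\mathbb{A}$, and $T$ a discrete interval exchange transformation with pair of orders $\pi$. Then for all trajectories $v_i^\infty$ and $v_j^\infty$ of $T$ (with $v_i,v_j$ primitive words) we have $\Delta(v_i,v_j)=0$.
   Context: $\Omega=(\Omega_{a,b})_{a,b\in\mathbb{A}}$ is the skew-symmetric matrix with $\Omega_{a,b}=+1$ if $b<_A a$ and $a<_D b$; $\Omega_{a,b}=-1$ if $b<_D a$ and $a<_A b$; $\Omega_{a,b}=0$ otherwise. For words $u,v$ over $\mathbb{A}$, $\Delta(u,v)=\lambda(u)^T\Omega\lambda(v)$, where $\lambda(w)=(|w|_a)_{a\in\mathbb{A}}$ is the Parikh vector of $w$ ($|w|_a$ is the number of occurrences of $a$ in $w$). A discrete interval exchange transformation with pair of orders $\pi$ and length vector $\lambda=(\lambda_a)_{a\in\mathbb{A}}$ (nonnegative integers, with sum $m\ge1$) is the bijection $T:I\to I$ of $I=\{1,\ldots,m\}$ obtained as follows: $I$ is partitioned into intervals $I_a$ ($a\in\mathbb{A}$) of consecutive integers with $|I_a|=\lambda_a$, placed from left to right in increasing order of $a$ with respect to $<_D$; the images $T(I_a)$ are also intervals partitioning $I$, placed from left to right in increasing order of $a$ with respect to $<_A$; and the restriction of $T$ to each $I_a$ is a translation. The natural coding of the trajectory (orbit) of $x\in I$ is the bi-infinite word $(x_n)_{n\in\mathbb{Z}}$ with $x_n=a$ iff $T^n(x)\in I_a$; it is written $v^\infty=\cdots vvv\cdots$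 with $v$ a primitive word (not a proper power), determined up to cyclic rotation. *)

theory Defs
  imports "HOL-Analysis.Cartesian_Euclidean_Space" "HOL-Library.Disjoint_Sets"
begin

text \<open>
  Orders are strict and given as relations: \<open>(a, b) \<in> D\<close> means \<open>a <\<^sub>D b\<close>.
  Throughout, \<open>D\<close> is the order \<open><\<^sub>D\<close> of the intervals and \<open>A\<close> the order
  \<open><\<^sub>A\<close> of their images.
\<close>

definition Omega :: "'a rel \<Rightarrow> 'a rel \<Rightarrow> real ^ 'a ^ 'a::finite" where
  "Omega D A = (\<chi> a b.
     if (b, a) \<in> A \<and> (a, b) \<in> D then 1
     else if (b, a) \<in> D \<and> (a, b) \<in> A then - 1
     else 0)"

definition parikh :: "'a list \<Rightarrow> real ^ 'a::finite" where
  "parikh w = (\<chi> a. real (count_list w a))"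

definition Delta :: "'a::finite rel \<Rightarrow> 'a rel \<Rightarrow> 'a list \<Rightarrow> 'a list \<Rightarrow> real" where
  "Delta D A u v = parikh u \<bullet> (Omega D A *v parikh v)"

definition iet_points :: "('a::finite \<Rightarrow> nat) \<Rightarrow> int set" where
  "iet_points l = {1..int (\<Sum>a\<in>UNIV. l a)}"

text \<open>The intervals \<open>J a\<close> may be empty, as lengths are allowed to be zero.\<close>

definition ordered_interval_partition :: "'a rel \<Rightarrow> int set \<Rightarrow> ('a \<Rightarrow> int set) \<Rightarrow> bool" where
  "ordered_interval_partition r S J \<longleftrightarrow>
     (\<forall>a. \<exists>s t. J a = {s..t}) \<and>
     disjoint_family J \<and>
     (\<Union>a. J a) = S \<and>
     (\<forall>a b. (a, b) \<in> r \<longrightarrow> (\<forall>x\<in>J a. \<forall>y\<in>J b. x < y))"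

text \<open>
  \<open>T\<close> is the discrete interval exchange transformation with orders \<open>D\<close>, \<open>A\<close>, length vector
  \<open>l\<close> and intervals \<open>I a\<close>; the family \<open>I\<close> and the values of \<open>T\<close> on \<open>iet_points l\<close> are determined
  by \<open>D\<close>, \<open>A\<close>, \<open>l\<close>, and the values of \<open>T\<close> elsewhere are irrelevant.
\<close>

definition discrete_iet ::
    "'a::finite rel \<Rightarrow> 'a rel \<Rightarrow> ('a \<Rightarrow> nat) \<Rightarrow> ('a \<Rightarrow> int set) \<Rightarrow> (int \<Rightarrow> int) \<Rightarrow> bool" where
  "discrete_iet D A l I T \<longleftrightarrow>
     (\<Sum>a\<in>UNIV. l a) \<ge> 1 \<and>
     bij_betw T (iet_points l) (iet_points l) \<and>
     (\<forall>a. card (I a) = l a) \<and>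
     ordered_interval_partition D (iet_points l) I \<and>
     ordered_interval_partition A (iet_points l) (\<lambda>a. T ` I a) \<and>
     (\<forall>a. \<exists>c. \<forall>x\<in>I a. T x = x + c)"

definition int_iterate :: "int set \<Rightarrow> (int \<Rightarrow> int) \<Rightarrow> int \<Rightarrow> int \<Rightarrow> int" where
  "int_iterate S T n x =
     (if n \<ge> 0 then (T ^^ nat n) x else (inv_into S T ^^ nat (- n)) x)"

definition natural_coding ::
    "('a::finite \<Rightarrow> nat) \<Rightarrow> ('a \<Rightarrow> int set) \<Rightarrow> (int \<Rightarrow> int) \<Rightarrow> int \<Rightarrow> int \<Rightarrow> 'a" where
  "natural_coding l I T x n = (THE a. int_iterate (iet_points l) T n x \<in> I a)"

definition primitive_word :: "'a list \<Rightarrow> bool" where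
  "primitive_word v \<longleftrightarrow> v \<noteq> [] \<and> (\<forall>u k. v = concat (replicate k u) \<longrightarrow> k = 1)"

text \<open>The bi-infinite word \<open>\<dots>vvv\<dots>\<close>, with a copy of \<open>v\<close> starting at index 0.\<close>

definition biinfinite_power :: "'a list \<Rightarrow> int \<Rightarrow> 'a" where
  "biinfinite_power v n = v ! nat (n mod int (length v))"

text \<open>
  Changing the starting point \<open>x\<close> within its orbit replaces \<open>v\<close> by a cyclic rotation, so all
  rotations of \<open>v\<close> are covered.
\<close>

definition is_trajectory_of ::
    "'a list \<Rightarrow> ('a::finite \<Rightarrow> nat) \<Rightarrow> ('a \<Rightarrow> int set) \<Rightarrow> (int \<Rightarrow> int) \<Rightarrow> bool" where
  "is_trajectory_of v l I T \<longleftrightarrow>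
     (\<exists>x\<in>iet_points l. natural_coding l I T x = biinfinite_power v)"

end

theory Submission imports Defs begin

text \<open>
  Fix a point \<open>y\<close> with coding \<open>w\<^sup>\<infinity>\<close> and let \<open>r z\<close> be the number of \<open>m < length w\<close> with
  \<open>T\<^sup>m y < z\<close>: a rank function that only sees the orbit of \<open>y\<close>. Two comparisons give the theorem.

  The orbit of \<open>y\<close> is closed and \<open>T\<close> merely permutes it, so \<open>r (T z)\<close> also counts the \<open>m\<close> with
  \<open>T (T\<^sup>m y) < T z\<close>. Hence \<open>r (T z) - r z\<close> adds up, over the points \<open>u\<close> of the orbit of \<open>y\<close>, the
  change that \<open>T\<close> makes in the truth value of \<open>u < z\<close>. If \<open>u\<close> lies in the interval of \<open>b\<close> and \<open>z\<close>
  in that of \<open>a\<close>, this change is exactly \<open>\<Omega>\<^bsub>a,b\<^esub>\<close> (lemma \<open>order_change_eq_Omega\<close>), because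
  the order of the intervals is \<open>D\<close> before applying \<open>T\<close> and \<open>A\<close> afterwards. So
  \<open>r (T z) - r z = (\<Omega> \<lambda>(w))\<^sub>a\<close>, the translation of the interval of \<open>a\<close> in the interval exchange
  with the same two orders and lengths \<open>\<lambda>(w)\<close>.

  Now let \<open>z\<close> run through the orbit of a point \<open>x\<close> with coding \<open>v\<^sup>\<infinity>\<close>. The increments of \<open>r\<close> add up
  to \<open>\<lambda>(v)\<^sup>T \<Omega> \<lambda>(w)\<close>, and they telescope to \<open>0\<close> because this orbit is closed as well.

  Both orbits close up after one reading of the coding word
  (lemma \<open>periodic_coding_imp_periodic_point\<close>): reading the word translates the point by a constant,
  which must vanish since the orbit is bounded.
\<close>

lemma sum_count_list_eq_sum_nth:
  fixes f :: "'a::finite \<Rightarrow> real"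
  shows "(\<Sum>a\<in>UNIV. real (count_list v a) * f a) = (\<Sum>n<length v. f (v ! n))"
proof (induction v)
  case Nil
  show ?case by simp
next
  case (Cons c v)
  have "(\<Sum>a\<in>UNIV. real (count_list (c # v) a) * f a)
      = (\<Sum>a\<in>UNIV. real (count_list v a) * f a + (if a = c then f a else 0))"
    by (rule sum.cong) (auto simp: algebra_simps)
  also have "\<dots> = f c + (\<Sum>n<length v. f (v ! n))"
    by (simp add: sum.distrib Cons.IH)
  also have "\<dots> = (\<Sum>n<length (c # v). f ((c # v) ! n))"
    by (simp add: sum.lessThan_Suc_shift del: sum.lessThan_Suc)
  finally show ?case .
qed

lemma Delta_eq_sum_nth:
  fixes D A :: "'a::finite rel"
  shows "Delta D A v w
       = (\<Sum>n<length v. \<Sum>m<length w. Omega D A $ (v ! n) $ (w ! m))"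
proof -
  have row: "(Omega D A *v parikh w) $ a = (\<Sum>m<length w. Omega D A $ a $ (w ! m))" for a
    using sum_count_list_eq_sum_nth[of w "\<lambda>b. Omega D A $ a $ b"]
    by (simp add: matrix_vector_mult_def parikh_def mult.commute)
  have "Delta D A v w = (\<Sum>a\<in>UNIV. real (count_list v a) * (Omega D A *v parikh w) $ a)"
    by (simp add: Delta_def inner_vec_def parikh_def)
  then show ?thesis
    by (simp add: sum_count_list_eq_sum_nth row)
qed

text \<open>
  A point of the interval of \<open>a\<close> and a point of the interval of \<open>b\<close> change their relative position
  under \<open>T\<close> precisely when \<open>D\<close> and \<open>A\<close> disagree on \<open>a\<close> and \<open>b\<close>; the entry of \<open>\<Omega>\<close> records the sense of
  the change. Within one interval \<open>T\<close> is a translation and preserves the order.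
\<close>

lemma order_change_eq_Omega:
  assumes "strict_linear_order D" and "strict_linear_order A"
    and T: "discrete_iet D A l I T"
    and z: "z \<in> I a" and u: "u \<in> I b"
  shows "of_bool (T u < T z) - of_bool (u < z) = Omega D A $ a $ b"
proof (cases "a = b")
  case True
  obtain c where "\<forall>x\<in>I a. T x = x + c"
    using T unfolding discrete_iet_def by blast
  then have "T u < T z \<longleftrightarrow> u < z"
    using True z u by simp
  moreover have "(a, a) \<notin> D" "(a, a) \<notin> A"
    using assms by (auto simp: strict_linear_order_on_def irrefl_def)
  ultimately show ?thesis
    using True by (simp add: Omega_def)
next
  case False
  have D: "x < y" if "(c, d) \<in> D" "x \<in> I c" "y \<in> I d" for c d x y
    using that T unfolding discrete_iet_def ordered_interval_partition_def by blast
  have A: "T x < T y" if "(c, d) \<in> A" "x \<in> I c" "y \<in> I d" for c d x y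
    using that T unfolding discrete_iet_def ordered_interval_partition_def by blast
  have total: "(a, b) \<in> D \<or> (b, a) \<in> D" "(a, b) \<in> A \<or> (b, a) \<in> A"
    using False assms(1,2) unfolding strict_linear_order_on_def total_on_def by blast+
  have before: "u < z \<longleftrightarrow> (b, a) \<in> D" "(a, b) \<in> D \<longleftrightarrow> (b, a) \<notin> D"
    using D[OF _ z u] D[OF _ u z] total(1) by (meson less_asym)+
  have after: "T u < T z \<longleftrightarrow> (b, a) \<in> A" "(a, b) \<in> A \<longleftrightarrow> (b, a) \<notin> A"
    using A[OF _ z u] A[OF _ u z] total(2) by (meson less_asym)+
  show ?thesis
    by (simp add: Omega_def before after)
qed

lemma discrete_iet_closed:
  assumes "discrete_iet D A l I T" and "x \<in> iet_points l"
  shows "(T ^^ n) x \<in> iet_points l"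
proof -
  have "T z \<in> iet_points l" if "z \<in> iet_points l" for z
    using assms(1) that unfolding discrete_iet_def bij_betw_def by blast
  then show ?thesis
    using assms(2) by (induction n) auto
qed

lemma natural_coding_mem:
  assumes T: "discrete_iet D A l I T" and x: "x \<in> iet_points l"
  shows "(T ^^ n) x \<in> I (natural_coding l I T x (int n))"
proof -
  have part: "disjoint_family I" "(\<Union>a. I a) = iet_points l"
    using T unfolding discrete_iet_def ordered_interval_partition_def by auto
  have "\<exists>!a. (T ^^ n) x \<in> I a"
  proof (rule ex_ex1I)
    show "\<exists>a. (T ^^ n) x \<in> I a"
      using part(2) discrete_iet_closed[OF T x, of n] by auto
    show "a = b" if "(T ^^ n) x \<in> I a" "(T ^^ n) x \<in> I b" for a b
      using part(1) that unfolding disjoint_family_on_def by (metis disjoint_iff UNIV_I)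
  qed
  from theI'[OF this] show ?thesis
    by (simp add: natural_coding_def int_iterate_def)
qed

text \<open>
  Equal letters mean equal translations, so under a coding of period \<open>p\<close> the displacement
  \<open>T\<^bsup>n+p\<^esup> x - T\<^sup>n x\<close> is independent of \<open>n\<close>. A nonzero displacement would accumulate and
  drive the orbit out of the finite set of points.
\<close>

lemma periodic_coding_imp_periodic_point:
  assumes T: "discrete_iet D A l I T" and x: "x \<in> iet_points l"
    and code: "\<And>n. (T ^^ n) x \<in> I (c n)" and per: "\<And>n. c (n + p) = c n"
  shows "(T ^^ p) x = x"
proof -
  have "\<forall>a. \<exists>s. \<forall>z\<in>I a. T z = z + s"
    using T unfolding discrete_iet_def by blast
  then obtain \<tau> where \<tau>: "\<And>a z. z \<in> I a \<Longrightarrow> T z = z + \<tau> a"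
    by metis
  have step: "(T ^^ Suc n) x = (T ^^ n) x + \<tau> (c n)" for n
    using \<tau>[OF code] by simp
  define d where "d = (T ^^ p) x - x"
  have displacement: "(T ^^ (n + p)) x = (T ^^ n) x + d" for n
  proof (induction n)
    case 0
    show ?case by (simp add: d_def)
  next
    case (Suc n)
    show ?case
      using step[of n] step[of "n + p"] Suc.IH by (simp add: per)
  qed
  have multiples: "(T ^^ (k * p)) x = x + int k * d" for k
  proof (induction k)
    case 0
    show ?case by simp
  next
    case (Suc k)
    show ?case
      using displacement[of "k * p"] Suc.IH by (simp add: algebra_simps)
  qed
  define m where "m = (\<Sum>a\<in>UNIV. l a)"
  \<comment> \<open>After as many repetitions as there are points, a nonzero displacement has left the set.\<close>
  have "x + int m * d \<in> {1..int m}" "x \<in> {1..int m}"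
    using discrete_iet_closed[OF T x, of "m * p"] multiples[of m] x
    by (auto simp: iet_points_def m_def)
  then have "\<bar>int m * d\<bar> < int m"
    by auto
  then have "int m * \<bar>d\<bar> < int m * 1"
    by (simp add: abs_mult)
  then have "\<bar>d\<bar> < 1"
    by (rule mult_left_less_imp_less) simp
  then show ?thesis
    by (simp add: d_def)
qed

lemma trajectory_orbit:
  assumes T: "discrete_iet D A l I T"
    and v: "is_trajectory_of v l I T"
  obtains x where "x \<in> iet_points l" "(T ^^ length v) x = x"
    "\<And>n. n < length v \<Longrightarrow> (T ^^ n) x \<in> I (v ! n)"
proof -
  obtain x where x: "x \<in> iet_points l"
    and coding: "natural_coding l I T x = biinfinite_power v"
    using v unfolding is_trajectory_of_def by blast
  have code: "(T ^^ n) x \<in> I (v ! (n mod length v))" for n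
    using natural_coding_mem[OF T x, of n]
    by (simp add: coding biinfinite_power_def nat_mod_distrib)
  have "(T ^^ length v) x = x"
    by (rule periodic_coding_imp_periodic_point[OF T x code]) simp
  moreover have "(T ^^ n) x \<in> I (v ! n)" if "n < length v" for n
    using code[of n] that by simp
  ultimately show thesis
    using x that by blast
qed

text \<open>The two ends of the telescoping sum are the same point of a closed orbit.\<close>

lemma sum_closed_orbit_Suc:
  fixes f :: "'b \<Rightarrow> real"
  assumes "(T ^^ p) x = x"
  shows "(\<Sum>n<p. f ((T ^^ Suc n) x)) = (\<Sum>n<p. f ((T ^^ n) x))"
proof -
  have "(\<Sum>n<p. f ((T ^^ Suc n) x) - f ((T ^^ n) x)) = f ((T ^^ p) x) - f ((T ^^ 0) x)"
    by (rule sum_lessThan_telescope)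
  then show ?thesis
    using assms by (simp add: sum_subtractf)
qed

theorem corollary8:
  fixes D A :: "'a::finite rel"
    and l :: "'a \<Rightarrow> nat"
    and I :: "'a \<Rightarrow> int set"
    and T :: "int \<Rightarrow> int"
    and v w :: "'a list"
  assumes "strict_linear_order D" and "strict_linear_order A" and "D \<noteq> A"
    and "discrete_iet D A l I T"
    and "primitive_word v" and "is_trajectory_of v l I T"
    and "primitive_word w" and "is_trajectory_of w l I T"
  shows "Delta D A v w = 0"
proof -
  obtain x where x: "(T ^^ length v) x = x"
    and x_code: "\<And>n. n < length v \<Longrightarrow> (T ^^ n) x \<in> I (v ! n)"
    using trajectory_orbit[OF assms(4,6)] by blast
  obtain y where y: "(T ^^ length w) y = y"
    and y_code: "\<And>m. m < length w \<Longrightarrow> (T ^^ m) y \<in> I (w ! m)"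
    using trajectory_orbit[OF assms(4,8)] by blast
  define r :: "int \<Rightarrow> real" where "r z = (\<Sum>m<length w. of_bool ((T ^^ m) y < z))" for z
  have increment: "r ((T ^^ Suc n) x) - r ((T ^^ n) x)
      = (\<Sum>m<length w. Omega D A $ (v ! n) $ (w ! m))" if n: "n < length v" for n
  proof -
    let ?z = "(T ^^ n) x"
    \<comment> \<open>Shifting the orbit of \<open>y\<close> by one step lets the same pairs be compared before and after \<open>T\<close>.\<close>
    have "r (T ?z) = (\<Sum>m<length w. of_bool (T ((T ^^ m) y) < T ?z))"
      using sum_closed_orbit_Suc[OF y, of "\<lambda>u. of_bool (u < T ?z)"] by (simp add: r_def)
    then have "r (T ?z) - r ?z
        = (\<Sum>m<length w. of_bool (T ((T ^^ m) y) < T ?z) - of_bool ((T ^^ m) y < ?z))"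
      by (simp add: r_def sum_subtractf)
    also have "\<dots> = (\<Sum>m<length w. Omega D A $ (v ! n) $ (w ! m))"
      by (intro sum.cong refl order_change_eq_Omega[OF assms(1,2,4) x_code[OF n] y_code]) simp
    finally show ?thesis by simp
  qed
  have "Delta D A v w = (\<Sum>n<length v. r ((T ^^ Suc n) x) - r ((T ^^ n) x))"
    unfolding Delta_eq_sum_nth by (intro sum.cong refl increment[symmetric]) simp
  also have "\<dots> = 0"
    using sum_closed_orbit_Suc[OF x, of r] by (simp add: sum_subtractf)
  finally show ?thesis .
qed

end
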